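(* Let $G$ be a finite group and let $k$ be any field. The usual $G$-grading of the group algebra $kG$ (in which each $g\in G$ is homogeneous of degree $g$) is simply connected.
   Context: A $k$-category is a small category $\mathcal B$ whose morphism sets ${}_y\mathcal B_x$ (from $x$ to $y$) are $k$-vector spaces with $k$-bilinear composition; a $k$-algebra is viewed as a $k$-category with one object. A grading $X$ of $\mathcal B$ by a group $\Gamma$ is a decomposition ${}_y\mathcal B_x=\bigoplus_{s\in\Gamma}X^s({}_y\mathcal B_x)$ with $X^t({}_z\mathcal B_y)X^s({}_y\mathcal B_x)\subset X^{ts}({}_z\mathcal B_x)$. A non-zero walk is a finite composable sequence $(f_n,\epsilon_n)\cdots(f_1,\epsilon_1)$ of non-zero morphisms with signs $\epsilon_i=\pm1$ (sign $-1$ exchanges source and target); if all $f_i$ are homogeneous its degree is $(\deg f_n)^{\epsilon_n}\cdots(\deg f_1)^{\epsilon_1}$. $\mathcal B$ is connected if any two objects are joined by a non-zero walk; the grading is connected if any two objects can be joined by a non-zero homogeneous walk of any prescribed degree in $\Gamma$ (for an algebra this means that the support $\{s\in\Gamma: X^sA\ne0\}$ generates $\Gamma$). The smash product category $\mathcal B\#\Gamma$ has objects $\mathcal B_0\times\Gamma$; the morphisms from $(b,g)$ to $(c,h)$ are $X^{h^{-1}g}({}_c\mathcal B_b)$; composition is that of $\mathcal B$. A connected $k$-category is simply connected if its only connected grading is the trivial grading (i.e. the one by the trivial group). A connected grading of $\mathcal B$ by $\Gamma$ is simply connected if the corresponding Galois covering $\mathcal B\#\Gamma\to\mathcal B$ is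 simply connected, i.e. the $k$-category $\mathcal B\#\Gamma$ is simply connected. *)

theory Defs
  imports "HOL-Algebra.Module"
begin

section \<open>Categories enriched in vector spaces\<close>

text \<open>
  As in the notation for \<open>k\<close>-categories used here, \<open>Mor B y x\<close> is the space of morphisms
  \<^emph>\<open>from\<close> \<open>x\<close> \<^emph>\<open>to\<close> \<open>y\<close>, and \<open>Cmp B z y x g f\<close> is \<open>g \<circ> f\<close> for \<open>f\<close> from \<open>x\<close> to \<open>y\<close>
  and \<open>g\<close> from \<open>y\<close> to \<open>z\<close>.  Different morphism spaces need not be disjoint.  Of the record
  \<open>Mor B y x\<close> only the \<open>K\<close>-module part matters; its ring multiplication and unit are not used.
\<close>

record ('o, 'k, 'm) kcat =
  Ob :: "'o set"
  Mor :: "'o \<Rightarrow> 'o \<Rightarrow> ('k, 'm) module"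
  Cmp :: "'o \<Rightarrow> 'o \<Rightarrow> 'o \<Rightarrow> 'm \<Rightarrow> 'm \<Rightarrow> 'm"
  Idn :: "'o \<Rightarrow> 'm"

locale k_category = field K
  for K :: "('k, 'c) ring_scheme" (structure) and B :: "('o, 'k, 'm) kcat" +
  assumes Mor_module: "\<lbrakk>x \<in> Ob B; y \<in> Ob B\<rbrakk> \<Longrightarrow> module K (Mor B y x)"
    and Idn_closed: "x \<in> Ob B \<Longrightarrow> Idn B x \<in> carrier (Mor B x x)"
    and Cmp_closed:
      "\<lbrakk>x \<in> Ob B; y \<in> Ob B; z \<in> Ob B; f \<in> carrier (Mor B y x); g \<in> carrier (Mor B z y)\<rbrakk>
        \<Longrightarrow> Cmp B z y x g f \<in> carrier (Mor B z x)"
    and Cmp_assoc: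
      "\<lbrakk>w \<in> Ob B; x \<in> Ob B; y \<in> Ob B; z \<in> Ob B;
        f \<in> carrier (Mor B x w); g \<in> carrier (Mor B y x); h \<in> carrier (Mor B z y)\<rbrakk>
        \<Longrightarrow> Cmp B z x w (Cmp B z y x h g) f = Cmp B z y w h (Cmp B y x w g f)"
    and Idn_left:
      "\<lbrakk>x \<in> Ob B; y \<in> Ob B; f \<in> carrier (Mor B y x)\<rbrakk> \<Longrightarrow> Cmp B y y x (Idn B y) f = f"
    and Idn_right:
      "\<lbrakk>x \<in> Ob B; y \<in> Ob B; f \<in> carrier (Mor B y x)\<rbrakk> \<Longrightarrow> Cmp B y x x f (Idn B x) = f"
    and Cmp_add_left:
      "\<lbrakk>x \<in> Ob B; y \<in> Ob B; z \<in> Ob B; f \<in> carrier (Mor B y x);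
        g \<in> carrier (Mor B z y); g' \<in> carrier (Mor B z y)\<rbrakk>
        \<Longrightarrow> Cmp B z y x (g \<oplus>\<^bsub>Mor B z y\<^esub> g') f
          = Cmp B z y x g f \<oplus>\<^bsub>Mor B z x\<^esub> Cmp B z y x g' f"
    and Cmp_add_right:
      "\<lbrakk>x \<in> Ob B; y \<in> Ob B; z \<in> Ob B; f \<in> carrier (Mor B y x); f' \<in> carrier (Mor B y x);
        g \<in> carrier (Mor B z y)\<rbrakk>
        \<Longrightarrow> Cmp B z y x g (f \<oplus>\<^bsub>Mor B y x\<^esub> f')
          = Cmp B z y x g f \<oplus>\<^bsub>Mor B z x\<^esub> Cmp B z y x g f'"
    and Cmp_smult_left:
      "\<lbrakk>x \<in> Ob B; y \<in> Ob B; z \<in> Ob B; a \<in> carrier K; f \<in> carrier (Mor B y x);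
        g \<in> carrier (Mor B z y)\<rbrakk>
        \<Longrightarrow> Cmp B z y x (a \<odot>\<^bsub>Mor B z y\<^esub> g) f = a \<odot>\<^bsub>Mor B z x\<^esub> Cmp B z y x g f"
    and Cmp_smult_right:
      "\<lbrakk>x \<in> Ob B; y \<in> Ob B; z \<in> Ob B; a \<in> carrier K; f \<in> carrier (Mor B y x);
        g \<in> carrier (Mor B z y)\<rbrakk>
        \<Longrightarrow> Cmp B z y x g (a \<odot>\<^bsub>Mor B y x\<^esub> f) = a \<odot>\<^bsub>Mor B z x\<^esub> Cmp B z y x g f"

text \<open>
  An algebra is given by a \<^typ>\<open>('k, 'm) module\<close> record, whose ring multiplication and unit
  are now those of the algebra.  (The locale \<^locale>\<open>algebra\<close> covers commutative algebras only.)
\<close>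

definition algebra_category :: "('k, 'm) module \<Rightarrow> (unit, 'k, 'm) kcat" where
  "algebra_category A =
    \<lparr>Ob = {()}, Mor = (\<lambda>_ _. A), Cmp = (\<lambda>_ _ _ g f. g \<otimes>\<^bsub>A\<^esub> f), Idn = (\<lambda>_. \<one>\<^bsub>A\<^esub>)\<rparr>"


section \<open>Gradings\<close>

definition internal_direct_sum :: "('k, 'm) module \<Rightarrow> 'i set \<Rightarrow> ('i \<Rightarrow> 'm set) \<Rightarrow> bool" where
  "internal_direct_sum M I N \<longleftrightarrow>
    (\<forall>f \<in> carrier M. \<exists>!c. c \<in> (\<Pi>\<^sub>E i\<in>I. N i) \<and> finite {i \<in> I. c i \<noteq> \<zero>\<^bsub>M\<^esub>} \<and>
      f = finsum M c {i \<in> I. c i \<noteq> \<zero>\<^bsub>M\<^esub>})"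

text \<open>\<open>X s y x\<close> is the degree \<open>s\<close> component of \<open>Mor B y x\<close>; only \<open>s \<in> carrier \<Gamma>\<close> is relevant.\<close>

locale k_category_grading = k_category K B + \<Gamma>: group \<Gamma>
  for K :: "('k, 'c) ring_scheme" (structure) and B :: "('o, 'k, 'm) kcat"
    and \<Gamma> :: "('g, 'd) monoid_scheme" (structure) and X :: "'g \<Rightarrow> 'o \<Rightarrow> 'o \<Rightarrow> 'm set" +
  assumes component_submodule:
      "\<lbrakk>x \<in> Ob B; y \<in> Ob B; s \<in> carrier \<Gamma>\<rbrakk> \<Longrightarrow> submodule (X s y x) K (Mor B y x)"
    and component_direct_sum:
      "\<lbrakk>x \<in> Ob B; y \<in> Ob B\<rbrakk>
        \<Longrightarrow> internal_direct_sum (Mor B y x) (carrier \<Gamma>) (\<lambda>s. X s y x)"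
    and component_Cmp:
      "\<lbrakk>x \<in> Ob B; y \<in> Ob B; z \<in> Ob B; s \<in> carrier \<Gamma>; t \<in> carrier \<Gamma>; f \<in> X s y x; g \<in> X t z y\<rbrakk>
        \<Longrightarrow> Cmp B z y x g f \<in> X (t \<otimes>\<^bsub>\<Gamma>\<^esub> s) z x"

definition trivial_grading ::
  "('o, 'k, 'm) kcat \<Rightarrow> ('g, 'd) monoid_scheme \<Rightarrow> ('g \<Rightarrow> 'o \<Rightarrow> 'o \<Rightarrow> 'm set) \<Rightarrow> bool" where
  "trivial_grading B \<Gamma> X \<longleftrightarrow>
    carrier \<Gamma> = {\<one>\<^bsub>\<Gamma>\<^esub>} \<and>
    (\<forall>x \<in> Ob B. \<forall>y \<in> Ob B. X \<one>\<^bsub>\<Gamma>\<^esub> y x = carrier (Mor B y x))"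


section \<open>Walks and connectedness\<close>

datatype ('o, 'm) arrow = Arrow (target: 'o) (source: 'o) (mor: 'm)

text \<open>
  A walk \<open>(f\<^sub>n, \<epsilon>\<^sub>n) \<dots> (f\<^sub>1, \<epsilon>\<^sub>1)\<close> is a list in the order in which it is written, so the
  last entry is the first step.  The signs are \<open>1\<close> and \<open>- 1\<close>, and walks have at least one step.
\<close>

type_synonym ('o, 'm) walk = "(('o, 'm) arrow \<times> int) list"

definition step_source :: "('o, 'm) arrow \<times> int \<Rightarrow> 'o" where
  "step_source p = (if snd p = 1 then source (fst p) else target (fst p))"

definition step_target :: "('o, 'm) arrow \<times> int \<Rightarrow> 'o" where
  "step_target p = (if snd p = 1 then target (fst p) else source (fst p))"

definition nonzero_arrow :: "('o, 'k, 'm) kcat \<Rightarrow> ('o, 'm) arrow \<Rightarrow> bool" where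
  "nonzero_arrow B f \<longleftrightarrow>
    source f \<in> Ob B \<and> target f \<in> Ob B \<and>
    mor f \<in> carrier (Mor B (target f) (source f)) \<and>
    mor f \<noteq> \<zero>\<^bsub>Mor B (target f) (source f)\<^esub>"

text \<open>\<open>nonzero_walk B y x w\<close>: the list \<open>w\<close> is a non-zero walk from \<open>x\<close> to \<open>y\<close>.\<close>

definition nonzero_walk :: "('o, 'k, 'm) kcat \<Rightarrow> 'o \<Rightarrow> 'o \<Rightarrow> ('o, 'm) walk \<Rightarrow> bool" where
  "nonzero_walk B y x w \<longleftrightarrow>
    w \<noteq> [] \<and>
    (\<forall>p \<in> set w. nonzero_arrow B (fst p) \<and> snd p \<in> {1, - 1}) \<and>
    (\<forall>i. Suc i < length w \<longrightarrow> step_source (w ! i) = step_target (w ! Suc i)) \<and>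
    step_target (hd w) = y \<and> step_source (last w) = x"

definition homogeneous ::
  "('g, 'd) monoid_scheme \<Rightarrow> ('g \<Rightarrow> 'o \<Rightarrow> 'o \<Rightarrow> 'm set) \<Rightarrow> ('o, 'm) arrow \<Rightarrow> bool" where
  "homogeneous \<Gamma> X f \<longleftrightarrow> (\<exists>s \<in> carrier \<Gamma>. mor f \<in> X s (target f) (source f))"

text \<open>The degree is well defined for non-zero homogeneous morphisms.\<close>

definition arrow_deg ::
  "('g, 'd) monoid_scheme \<Rightarrow> ('g \<Rightarrow> 'o \<Rightarrow> 'o \<Rightarrow> 'm set) \<Rightarrow> ('o, 'm) arrow \<Rightarrow> 'g" where
  "arrow_deg \<Gamma> X f = (THE s. s \<in> carrier \<Gamma> \<and> mor f \<in> X s (target f) (source f))"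

definition homogeneous_walk ::
  "('g, 'd) monoid_scheme \<Rightarrow> ('g \<Rightarrow> 'o \<Rightarrow> 'o \<Rightarrow> 'm set) \<Rightarrow> ('o, 'm) walk \<Rightarrow> bool" where
  "homogeneous_walk \<Gamma> X w \<longleftrightarrow> (\<forall>p \<in> set w. homogeneous \<Gamma> X (fst p))"

definition walk_deg ::
  "('g, 'd) monoid_scheme \<Rightarrow> ('g \<Rightarrow> 'o \<Rightarrow> 'o \<Rightarrow> 'm set) \<Rightarrow> ('o, 'm) walk \<Rightarrow> 'g" where
  "walk_deg \<Gamma> X w = foldr (\<lambda>p s. (arrow_deg \<Gamma> X (fst p) [^]\<^bsub>\<Gamma>\<^esub> snd p) \<otimes>\<^bsub>\<Gamma>\<^esub> s) w \<one>\<^bsub>\<Gamma>\<^esub>"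

definition connected_k_category :: "('k, 'c) ring_scheme \<Rightarrow> ('o, 'k, 'm) kcat \<Rightarrow> bool" where
  "connected_k_category K B \<longleftrightarrow>
    k_category K B \<and> (\<forall>x \<in> Ob B. \<forall>y \<in> Ob B. \<exists>w. nonzero_walk B y x w)"

definition connected_grading ::
  "('k, 'c) ring_scheme \<Rightarrow> ('o, 'k, 'm) kcat \<Rightarrow> ('g, 'd) monoid_scheme \<Rightarrow>
    ('g \<Rightarrow> 'o \<Rightarrow> 'o \<Rightarrow> 'm set) \<Rightarrow> bool" where
  "connected_grading K B \<Gamma> X \<longleftrightarrow>
    k_category_grading K B \<Gamma> X \<and>
    (\<forall>x \<in> Ob B. \<forall>y \<in> Ob B. \<forall>s \<in> carrier \<Gamma>.
      \<exists>w. nonzero_walk B y x w \<and> homogeneous_walk \<Gamma> X w \<and> walk_deg \<Gamma> X w = s)"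


section \<open>Smash product and simple connectedness\<close>

definition smash ::
  "('o, 'k, 'm) kcat \<Rightarrow> ('g, 'd) monoid_scheme \<Rightarrow> ('g \<Rightarrow> 'o \<Rightarrow> 'o \<Rightarrow> 'm set) \<Rightarrow>
    ('o \<times> 'g, 'k, 'm) kcat" where
  "smash B \<Gamma> X =
    \<lparr>Ob = Ob B \<times> carrier \<Gamma>,
     Mor = (\<lambda>(c, h) (b, g). (Mor B c b)\<lparr>carrier := X (inv\<^bsub>\<Gamma>\<^esub> h \<otimes>\<^bsub>\<Gamma>\<^esub> g) c b\<rparr>),
     Cmp = (\<lambda>(d, l) (c, h) (b, g). Cmp B d c b),
     Idn = (\<lambda>(b, g). Idn B b)\<rparr>"

text \<open>
  Simple connectedness quantifies over gradings by all groups.  A formula cannot quantify over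
  types, so the type \<open>'h\<close> of the elements of the grading groups is an explicit parameter; a
  theorem that leaves \<open>'h\<close> a type variable speaks about all groups.
\<close>

definition simply_connected_k_category ::
  "'h itself \<Rightarrow> ('k, 'c) ring_scheme \<Rightarrow> ('o, 'k, 'm) kcat \<Rightarrow> bool" where
  "simply_connected_k_category T K B \<longleftrightarrow>
    connected_k_category K B \<and>
    (\<forall>(\<Gamma> :: 'h monoid) X. connected_grading K B \<Gamma> X \<longrightarrow> trivial_grading B \<Gamma> X)"

definition simply_connected_grading ::
  "'h itself \<Rightarrow> ('k, 'c) ring_scheme \<Rightarrow> ('o, 'k, 'm) kcat \<Rightarrow> ('g, 'd) monoid_scheme \<Rightarrow>
    ('g \<Rightarrow> 'o \<Rightarrow> 'o \<Rightarrow> 'm set) \<Rightarrow> bool" where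
  "simply_connected_grading T K B \<Gamma> X \<longleftrightarrow>
    connected_grading K B \<Gamma> X \<and> simply_connected_k_category T K (smash B \<Gamma> X)"


section \<open>The group algebra and its usual grading\<close>

text \<open>
  Elements are the finitely supported functions from the group to the field, made \<^const>\<open>undefined\<close>
  outside \<open>carrier G\<close>.  The convolution sums over the support of the left factor, since
  \<^const>\<open>finsum\<close> over an infinite set is not meaningful.
\<close>

definition group_algebra ::
  "('k, 'c) ring_scheme \<Rightarrow> ('g, 'd) monoid_scheme \<Rightarrow> ('k, 'g \<Rightarrow> 'k) module" where
  "group_algebra K G =
    \<lparr>carrier = {f \<in> carrier G \<rightarrow>\<^sub>E carrier K. finite {g \<in> carrier G. f g \<noteq> \<zero>\<^bsub>K\<^esub>}},
     monoid.mult = (\<lambda>f h. \<lambda>x\<in>carrier G.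
       \<Oplus>\<^bsub>K\<^esub>a\<in>{a \<in> carrier G. f a \<noteq> \<zero>\<^bsub>K\<^esub>}. f a \<otimes>\<^bsub>K\<^esub> h (inv\<^bsub>G\<^esub> a \<otimes>\<^bsub>G\<^esub> x)),
     one = (\<lambda>x\<in>carrier G. if x = \<one>\<^bsub>G\<^esub> then \<one>\<^bsub>K\<^esub> else \<zero>\<^bsub>K\<^esub>),
     zero = (\<lambda>x\<in>carrier G. \<zero>\<^bsub>K\<^esub>),
     add = (\<lambda>f h. \<lambda>x\<in>carrier G. f x \<oplus>\<^bsub>K\<^esub> h x),
     smult = (\<lambda>a f. \<lambda>x\<in>carrier G. a \<otimes>\<^bsub>K\<^esub> f x)\<rparr>"

definition group_basis ::
  "('k, 'c) ring_scheme \<Rightarrow> ('g, 'd) monoid_scheme \<Rightarrow> 'g \<Rightarrow> 'g \<Rightarrow> 'k" where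
  "group_basis K G g = (\<lambda>x\<in>carrier G. if x = g then \<one>\<^bsub>K\<^esub> else \<zero>\<^bsub>K\<^esub>)"

definition usual_grading ::
  "('k, 'c) ring_scheme \<Rightarrow> ('g, 'd) monoid_scheme \<Rightarrow> 'g \<Rightarrow> unit \<Rightarrow> unit \<Rightarrow> ('g \<Rightarrow> 'k) set" where
  "usual_grading K G g = (\<lambda>_ _.
    {a \<odot>\<^bsub>group_algebra K G\<^esub> group_basis K G g | a. a \<in> carrier K})"

end

theory Submission
  imports Defs
begin

text \<open>
  In the smash product \<open>kG # G\<close> the objects are the elements of \<open>G\<close>, and the morphisms from
  \<open>g\<close> to \<open>h\<close> are the multiples of the basis element \<open>h\<inverse> g\<close>.  So every morphism space is a
  line, and the composite of two non-zero morphisms is non-zero: up to scalars, \<open>kG # G\<close> is the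
  indiscrete groupoid on \<open>G\<close>.

  A category of this shape has no room for a non-trivial connected grading.  A line that is the
  direct sum of submodules is concentrated in one of them, so a grading by \<open>\<Gamma>\<close> amounts to one
  degree \<open>d(y, x)\<close> in \<open>\<Gamma>\<close> for each pair of objects.  Composing non-zero morphisms gives
  \<open>d(z, y) d(y, x) = d(z, x)\<close> (\<open>hom_deg_Cmp\<close>), hence \<open>d(x, x) = 1\<close> and
  \<open>d(x, y) = d(y, x)\<inverse>\<close>.  The degree of a walk from \<open>x\<close> to \<open>y\<close> therefore telescopes to
  \<open>d(y, x)\<close>, whatever the walk (\<open>walk_deg_eq_hom_deg\<close>); in particular closed walks have degree
  \<open>1\<close>.  If the grading is connected, each element of \<open>\<Gamma>\<close> is the degree of a closed walk, so
  \<open>\<Gamma>\<close> is trivial (\<open>connected_grading_trivial\<close>).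

  What remains is that \<open>kG\<close> is an associative algebra graded by \<open>G\<close>, that the smash product of
  a graded category is again a \<open>k\<close>-category (\<open>smash_k_category\<close>), and that \<open>kG # G\<close> has the shape
  described above (\<open>line_category_smash\<close>).
\<close>

section \<open>Gradings of categories with one-dimensional morphism spaces\<close>

locale k_vector_space = module R M + F: field R
  for R :: "('k, 'c) ring_scheme" (structure) and M :: "('k, 'm) module" (structure)
begin

text \<open>
  A non-zero vector \<open>m = a e\<close> of the line spanned by \<open>e\<close> spans it too, because \<open>a\<close> is invertible.
\<close>

lemma line_submodule:
  assumes e: "e \<in> carrier M" and line: "carrier M = {a \<odot>\<^bsub>M\<^esub> e | a. a \<in> carrier R}"
    and N: "submodule N R M" and m: "m \<in> N" "m \<noteq> \<zero>\<^bsub>M\<^esub>"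
  shows "N = carrier M"
proof
  interpret N: submodule N R M by fact
  show sub: "N \<subseteq> carrier M" using submoduleE(1)[OF N] .
  obtain a where a: "a \<in> carrier R" "m = a \<odot>\<^bsub>M\<^esub> e" using sub m(1) line by auto
  have "a \<noteq> \<zero>" using a m e by auto
  then have inv: "inv a \<in> carrier R" "inv a \<otimes> a = \<one>"
    using a F.field_Units by (auto simp: Units_l_inv)
  have "e = inv a \<odot>\<^bsub>M\<^esub> m" using a inv e by (simp flip: smult_assoc1)
  then have "e \<in> N" using m(1) inv by auto
  then show "carrier M \<subseteq> N" using line by auto
qed

text \<open>
  A common non-zero element of two different components would have two decompositions, one
  concentrated in each of the two degrees.
\<close>

lemma direct_sum_components_disjoint:
  assumes ds: "internal_direct_sum M I N" and sub: "\<And>i. i \<in> I \<Longrightarrow> submodule (N i) R M"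
    and ij: "i \<in> I" "j \<in> I" and m: "m \<in> N i" "m \<in> N j" "m \<noteq> \<zero>\<^bsub>M\<^esub>"
  shows "i = j"
proof -
  define c where "c = (\<lambda>i. \<lambda>l\<in>I. if l = i then m else \<zero>\<^bsub>M\<^esub>)"
  have mM: "m \<in> carrier M" using submoduleE(1)[OF sub[OF ij(1)]] m by auto
  have zero: "\<zero>\<^bsub>M\<^esub> \<in> N l" if "l \<in> I" for l
    using subgroup.one_closed[OF submodule.axioms(1)[OF sub[OF that]]] by simp
  have c: "c i \<in> (\<Pi>\<^sub>E i\<in>I. N i) \<and> finite {l \<in> I. c i l \<noteq> \<zero>\<^bsub>M\<^esub>} \<and>
      m = finsum M (c i) {l \<in> I. c i l \<noteq> \<zero>\<^bsub>M\<^esub>}" if "i \<in> I" "m \<in> N i" for i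
  proof -
    have "{l \<in> I. c i l \<noteq> \<zero>\<^bsub>M\<^esub>} = {i}" using that m by (auto simp: c_def)
    then show ?thesis using that mM zero by (auto simp: c_def)
  qed
  have "c i = c j"
    using ds mM c[OF ij(1) m(1)] c[OF ij(2) m(2)] unfolding internal_direct_sum_def by blast
  then have "c i i = c j i" by simp
  then show ?thesis using ij m by (auto simp: c_def split: if_splits)
qed

text \<open>
  Some component of the spanning vector \<open>e\<close> is non-zero, and then its summand is the whole line;
  two such summands would meet in \<open>e\<close>.
\<close>

lemma direct_sum_line:
  assumes e: "e \<in> carrier M" "e \<noteq> \<zero>\<^bsub>M\<^esub>"
    and line: "carrier M = {a \<odot>\<^bsub>M\<^esub> e | a. a \<in> carrier R}"
    and ds: "internal_direct_sum M I N" and sub: "\<And>i. i \<in> I \<Longrightarrow> submodule (N i) R M"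
  shows "\<exists>!i. i \<in> I \<and> N i = carrier M"
proof -
  obtain c where c: "c \<in> (\<Pi>\<^sub>E i\<in>I. N i)" "e = finsum M c {i \<in> I. c i \<noteq> \<zero>\<^bsub>M\<^esub>}"
    using ds e unfolding internal_direct_sum_def by blast
  have "{i \<in> I. c i \<noteq> \<zero>\<^bsub>M\<^esub>} \<noteq> {}"
    using c(2) e(2) M.finsum_empty by metis
  then obtain i where i: "i \<in> I" "c i \<noteq> \<zero>\<^bsub>M\<^esub>" by blast
  with c have "c i \<in> N i" by auto
  then have "N i = carrier M"
    using line_submodule[OF e(1) line sub] i by blast
  moreover have "j = i" if "j \<in> I" "N j = carrier M" for j
    using direct_sum_components_disjoint[OF ds sub] that i calculation e by blast
  ultimately show ?thesis using i by blast
qed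

end

text \<open>
  Any two objects are joined by non-zero morphisms in both directions, and these compose to
  non-zero morphisms.  Up to scalars such a category is an indiscrete groupoid.
\<close>

locale line_category = k_category K B
  for K :: "('k, 'c) ring_scheme" (structure) and B :: "('o, 'k, 'm) kcat" +
  assumes Mor_line: "\<lbrakk>x \<in> Ob B; y \<in> Ob B\<rbrakk> \<Longrightarrow> \<exists>e \<in> carrier (Mor B y x).
      e \<noteq> \<zero>\<^bsub>Mor B y x\<^esub> \<and> carrier (Mor B y x) = {a \<odot>\<^bsub>Mor B y x\<^esub> e | a. a \<in> carrier K}"
    and Cmp_nonzero: "\<lbrakk>x \<in> Ob B; y \<in> Ob B; z \<in> Ob B;
      f \<in> carrier (Mor B y x); f \<noteq> \<zero>\<^bsub>Mor B y x\<^esub>; g \<in> carrier (Mor B z y); g \<noteq> \<zero>\<^bsub>Mor B z y\<^esub>\<rbrakk>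
      \<Longrightarrow> Cmp B z y x g f \<noteq> \<zero>\<^bsub>Mor B z x\<^esub>"

lemma (in line_category) connected: "connected_k_category K B"
  unfolding connected_k_category_def
proof (intro conjI k_category_axioms ballI)
  fix x y assume "x \<in> Ob B" "y \<in> Ob B"
  note xy = this
  obtain f where "f \<in> carrier (Mor B y x)" "f \<noteq> \<zero>\<^bsub>Mor B y x\<^esub>"
    using Mor_line[OF xy] by blast
  with xy have "nonzero_walk B y x [(Arrow y x f, 1)]"
    by (simp add: nonzero_walk_def nonzero_arrow_def step_target_def step_source_def)
  then show "\<exists>w. nonzero_walk B y x w" ..
qed

locale graded_line_category = line_category K B + k_category_grading K B \<Gamma> X
  for K :: "('k, 'c) ring_scheme" (structure) and B :: "('o, 'k, 'm) kcat"
    and \<Gamma> :: "('g, 'd) monoid_scheme" (structure) and X :: "'g \<Rightarrow> 'o \<Rightarrow> 'o \<Rightarrow> 'm set"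
begin

text \<open>
  Since \<open>Mor B y x\<close> is a line, exactly one of its homogeneous components is non-zero;
  \<open>hom_deg y x\<close> is the degree of that component.
\<close>

definition hom_deg :: "'o \<Rightarrow> 'o \<Rightarrow> 'g" where
  "hom_deg y x = (THE s. s \<in> carrier \<Gamma> \<and> X s y x = carrier (Mor B y x))"

lemma hom_deg:
  assumes xy: "x \<in> Ob B" "y \<in> Ob B"
  shows hom_deg_closed: "hom_deg y x \<in> carrier \<Gamma>"
    and X_hom_deg: "X (hom_deg y x) y x = carrier (Mor B y x)"
proof -
  interpret M: k_vector_space K "Mor B y x"
    by (intro k_vector_space.intro Mor_module[OF xy] field_axioms)
  obtain e where e: "e \<in> carrier (Mor B y x)" "e \<noteq> \<zero>\<^bsub>Mor B y x\<^esub>"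
    "carrier (Mor B y x) = {a \<odot>\<^bsub>Mor B y x\<^esub> e | a. a \<in> carrier K}"
    using Mor_line[OF xy] by blast
  have "\<exists>!s. s \<in> carrier \<Gamma> \<and> X s y x = carrier (Mor B y x)"
    by (rule M.direct_sum_line[OF e component_direct_sum[OF xy] component_submodule[OF xy]])
  from theI'[OF this]
  show "hom_deg y x \<in> carrier \<Gamma>" "X (hom_deg y x) y x = carrier (Mor B y x)"
    unfolding hom_deg_def by auto
qed

lemma hom_deg_unique:
  assumes xy: "x \<in> Ob B" "y \<in> Ob B" and s: "s \<in> carrier \<Gamma>"
    and f: "f \<in> X s y x" "f \<noteq> \<zero>\<^bsub>Mor B y x\<^esub>"
  shows "s = hom_deg y x"
proof -
  interpret M: k_vector_space K "Mor B y x"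
    by (intro k_vector_space.intro Mor_module[OF xy] field_axioms)
  have "f \<in> carrier (Mor B y x)"
    using M.submoduleE(1)[OF component_submodule[OF xy s]] f by blast
  then have f': "f \<in> X (hom_deg y x) y x" using X_hom_deg[OF xy] by simp
  show ?thesis
    by (rule M.direct_sum_components_disjoint[OF component_direct_sum[OF xy]
          component_submodule[OF xy] s hom_deg_closed[OF xy] f(1) f' f(2)])
qed

text \<open>
  The composite of two non-zero morphisms is non-zero, and its degree is the product of their
  degrees by the multiplicativity of the grading.
\<close>

lemma hom_deg_Cmp:
  assumes "x \<in> Ob B" "y \<in> Ob B" "z \<in> Ob B"
  shows "hom_deg z y \<otimes>\<^bsub>\<Gamma>\<^esub> hom_deg y x = hom_deg z x"
proof -
  obtain f where f: "f \<in> carrier (Mor B y x)" "f \<noteq> \<zero>\<^bsub>Mor B y x\<^esub>"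
    using Mor_line[OF assms(1,2)] by blast
  obtain g where g: "g \<in> carrier (Mor B z y)" "g \<noteq> \<zero>\<^bsub>Mor B z y\<^esub>"
    using Mor_line[OF assms(2,3)] by blast
  show ?thesis
  proof (rule hom_deg_unique)
    show "Cmp B z y x g f \<in> X (hom_deg z y \<otimes>\<^bsub>\<Gamma>\<^esub> hom_deg y x) z x"
      using assms f g by (intro component_Cmp) (auto simp: hom_deg_closed X_hom_deg)
    show "Cmp B z y x g f \<noteq> \<zero>\<^bsub>Mor B z x\<^esub>" using assms f g by (intro Cmp_nonzero)
  qed (use assms hom_deg_closed in auto)
qed

text \<open>By the cocycle rule \<open>hom_deg x x\<close> is idempotent, and \<open>\<one>\<close> is the only idempotent of a group.\<close>

lemma hom_deg_refl:
  assumes "x \<in> Ob B"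
  shows "hom_deg x x = \<one>\<^bsub>\<Gamma>\<^esub>"
  using hom_deg_Cmp[OF assms assms assms] hom_deg_closed[OF assms assms] by simp

lemma inv_hom_deg:
  assumes "x \<in> Ob B" "y \<in> Ob B"
  shows "inv\<^bsub>\<Gamma>\<^esub> (hom_deg y x) = hom_deg x y"
  using hom_deg_Cmp[of y x y] hom_deg_refl assms hom_deg_closed
  by (metis \<Gamma>.inv_equality hom_deg_Cmp)

lemma arrow_deg_eq_hom_deg:
  assumes "nonzero_arrow B f"
  shows "arrow_deg \<Gamma> X f = hom_deg (target f) (source f)"
  unfolding arrow_deg_def
proof (rule the_equality)
  show "hom_deg (target f) (source f) \<in> carrier \<Gamma> \<and>
    mor f \<in> X (hom_deg (target f) (source f)) (target f) (source f)"
    using assms hom_deg by (auto simp: nonzero_arrow_def)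
  show "s = hom_deg (target f) (source f)"
    if "s \<in> carrier \<Gamma> \<and> mor f \<in> X s (target f) (source f)" for s
    using assms that hom_deg_unique by (auto simp: nonzero_arrow_def)
qed

text \<open>
  A step with sign \<open>- 1\<close> runs backwards, and inverting the degree of its arrow exchanges the two
  objects, so that the degree of a step depends on its end points only.
\<close>

lemma step_deg:
  assumes "nonzero_arrow B (fst p)" "snd p \<in> {1, - 1}"
  shows "arrow_deg \<Gamma> X (fst p) [^]\<^bsub>\<Gamma>\<^esub> snd p = hom_deg (step_target p) (step_source p)"
proof -
  have ob: "source (fst p) \<in> Ob B" "target (fst p) \<in> Ob B"
    using assms by (auto simp: nonzero_arrow_def)
  have "g [^]\<^bsub>\<Gamma>\<^esub> (- 1 :: int) = inv\<^bsub>\<Gamma>\<^esub> g" if "g \<in> carrier \<Gamma>" for g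
    using that \<Gamma>.int_pow_neg[of g 1] by simp
  then show ?thesis
    using assms ob hom_deg_closed[OF ob]
    by (auto simp: step_target_def step_source_def arrow_deg_eq_hom_deg inv_hom_deg)
qed

text \<open>The degrees of the steps telescope by the cocycle rule.\<close>

lemma walk_deg_eq_hom_deg:
  assumes "nonzero_walk B y x w"
  shows "walk_deg \<Gamma> X w = hom_deg y x"
  using assms
proof (induction w arbitrary: y)
  case Nil
  then show ?case by (simp add: nonzero_walk_def)
next
  case (Cons p w)
  have p: "nonzero_arrow B (fst p)" "snd p \<in> {1, - 1}" "step_target p = y"
    using Cons.prems by (auto simp: nonzero_walk_def)
  have ob: "step_source p \<in> Ob B" "y \<in> Ob B"
    using p by (auto simp: step_source_def step_target_def nonzero_arrow_def)
  have split: "walk_deg \<Gamma> X (p # w) = hom_deg y (step_source p) \<otimes>\<^bsub>\<Gamma>\<^esub> walk_deg \<Gamma> X w"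
    using step_deg[OF p(1,2)] p(3) by (simp add: walk_deg_def)
  show ?case
  proof (cases "w = []")
    case True
    then show ?thesis
      using split Cons.prems ob hom_deg_closed[OF ob]
      by (simp add: walk_deg_def nonzero_walk_def)
  next
    case False
    have chain: "step_source ((p # w) ! i) = step_target ((p # w) ! Suc i)"
      if "Suc i < length (p # w)" for i
      using Cons.prems that unfolding nonzero_walk_def by blast
    have "step_source (w ! i) = step_target (w ! Suc i)" if "Suc i < length w" for i
      using chain[of "Suc i"] that by simp
    moreover have "step_target (hd w) = step_source p"
      using chain[of 0] False by (simp add: hd_conv_nth)
    ultimately have w: "nonzero_walk B (step_source p) x w"
      using Cons.prems False by (auto simp: nonzero_walk_def)
    have "step_source (last w) = x" "nonzero_arrow B (fst (last w))"
      using w by (auto simp: nonzero_walk_def)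
    then have "x \<in> Ob B"
      by (auto simp: step_source_def nonzero_arrow_def split: if_splits)
    then show ?thesis using split Cons.IH[OF w] hom_deg_Cmp ob by simp
  qed
qed

end

text \<open>
  The degree of a closed walk is \<open>\<one>\<close>, while connectedness provides closed walks of every degree.
  An object is needed to start them: on a category without objects every grading is connected.
\<close>

theorem (in line_category) connected_grading_trivial:
  assumes "Ob B \<noteq> {}" and conn: "connected_grading K B \<Gamma> X"
  shows "trivial_grading B \<Gamma> X"
proof -
  interpret k_category_grading K B \<Gamma> X
    using conn by (simp add: connected_grading_def)
  interpret graded_line_category K B \<Gamma> X ..
  obtain x where x: "x \<in> Ob B" using assms by blast
  have "s = \<one>\<^bsub>\<Gamma>\<^esub>" if "s \<in> carrier \<Gamma>" for s
  proof -
    have "\<exists>w. nonzero_walk B x x w \<and> homogeneous_walk \<Gamma> X w \<and> walk_deg \<Gamma> X w = s"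
      using conn x that by (simp add: connected_grading_def)
    then obtain w where "nonzero_walk B x x w" "walk_deg \<Gamma> X w = s" by blast
    then show ?thesis using walk_deg_eq_hom_deg hom_deg_refl[OF x] by simp
  qed
  then have \<Gamma>: "carrier \<Gamma> = {\<one>\<^bsub>\<Gamma>\<^esub>}" by auto
  have "X \<one>\<^bsub>\<Gamma>\<^esub> y x = carrier (Mor B y x)" if "x \<in> Ob B" "y \<in> Ob B" for x y
    using hom_deg[OF that] \<Gamma> by auto
  with \<Gamma> show ?thesis by (simp add: trivial_grading_def)
qed


section \<open>The smash product\<close>

lemma smash_simps [simp]:
  "Ob (smash B \<Gamma> X) = Ob B \<times> carrier \<Gamma>"
  "Mor (smash B \<Gamma> X) y x =
    (Mor B (fst y) (fst x))\<lparr>carrier := X (inv\<^bsub>\<Gamma>\<^esub> (snd y) \<otimes>\<^bsub>\<Gamma>\<^esub> snd x) (fst y) (fst x)\<rparr>"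
  "Cmp (smash B \<Gamma> X) z y x = Cmp B (fst z) (fst y) (fst x)"
  "Idn (smash B \<Gamma> X) x = Idn B (fst x)"
  by (simp_all add: smash_def split_beta)

text \<open>
  All laws are inherited from \<open>B\<close>, since the morphism spaces are submodules of those of \<open>B\<close>.
  Closure under composition holds because the degrees telescope:
  \<open>(l\<inverse> h) (h\<inverse> g) = l\<inverse> g\<close>.  Endomorphisms in the smash product have degree \<open>\<one>\<close>, so it
  contains the identities as soon as these are homogeneous of degree \<open>\<one>\<close>.
\<close>

lemma (in k_category_grading) smash_k_category:
  assumes Idn_deg: "\<And>x. x \<in> Ob B \<Longrightarrow> Idn B x \<in> X \<one>\<^bsub>\<Gamma>\<^esub> x x"
  shows "k_category K (smash B \<Gamma> X)"
proof -
  let ?S = "smash B \<Gamma> X"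
  have ob: "fst x \<in> Ob B" "snd x \<in> carrier \<Gamma>" if "x \<in> Ob ?S" for x
    using that by auto
  have sub: "f \<in> carrier (Mor B (fst y) (fst x))"
    if "x \<in> Ob ?S" "y \<in> Ob ?S" "f \<in> carrier (Mor ?S y x)" for f x y
  proof -
    have "X (inv\<^bsub>\<Gamma>\<^esub> (snd y) \<otimes>\<^bsub>\<Gamma>\<^esub> snd x) (fst y) (fst x) \<subseteq> carrier (Mor B (fst y) (fst x))"
      using ob[OF that(1)] ob[OF that(2)]
      by (intro module.submoduleE(1)[OF Mor_module component_submodule]) auto
    then show ?thesis using that(3) by auto
  qed
  have deg: "(inv\<^bsub>\<Gamma>\<^esub> l \<otimes>\<^bsub>\<Gamma>\<^esub> h) \<otimes>\<^bsub>\<Gamma>\<^esub> (inv\<^bsub>\<Gamma>\<^esub> h \<otimes>\<^bsub>\<Gamma>\<^esub> g) = inv\<^bsub>\<Gamma>\<^esub> l \<otimes>\<^bsub>\<Gamma>\<^esub> g"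
    if "g \<in> carrier \<Gamma>" "h \<in> carrier \<Gamma>" "l \<in> carrier \<Gamma>" for g h l
  proof -
    have "h \<otimes>\<^bsub>\<Gamma>\<^esub> (inv\<^bsub>\<Gamma>\<^esub> h \<otimes>\<^bsub>\<Gamma>\<^esub> g) = g" using that by (simp flip: \<Gamma>.m_assoc)
    then show ?thesis using that by (simp add: \<Gamma>.m_assoc)
  qed
  show ?thesis
  proof (intro k_category.intro k_category_axioms.intro field_axioms, goal_cases)
    case (1 x y)
    note o = ob[OF 1(1)] ob[OF 1(2)]
    have "submodule (X (inv\<^bsub>\<Gamma>\<^esub> (snd y) \<otimes>\<^bsub>\<Gamma>\<^esub> snd x) (fst y) (fst x)) K (Mor B (fst y) (fst x))"
      using o by (intro component_submodule) auto
    from submodule.submodule_is_module[OF this Mor_module] show ?case using o by simp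
  next
    case (2 x)
    then show ?case using ob[OF 2] by (simp add: Idn_deg)
  next
    case (3 x y z f g)
    note o = ob[OF 3(1)] ob[OF 3(2)] ob[OF 3(3)]
    have "Cmp B (fst z) (fst y) (fst x) g f \<in>
      X ((inv\<^bsub>\<Gamma>\<^esub> (snd z) \<otimes>\<^bsub>\<Gamma>\<^esub> snd y) \<otimes>\<^bsub>\<Gamma>\<^esub> (inv\<^bsub>\<Gamma>\<^esub> (snd y) \<otimes>\<^bsub>\<Gamma>\<^esub> snd x)) (fst z) (fst x)"
      using o 3 by (intro component_Cmp) auto
    with o show ?case by (simp add: deg)
  next
    case (4 w x y z f g h)
    show ?case
      using Cmp_assoc[OF ob(1)[OF 4(1)] ob(1)[OF 4(2)] ob(1)[OF 4(3)] ob(1)[OF 4(4)]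
          sub[OF 4(1,2,5)] sub[OF 4(2,3,6)] sub[OF 4(3,4,7)]] by simp
  next
    case (5 x y f)
    show ?case using Idn_left[OF ob(1)[OF 5(1)] ob(1)[OF 5(2)] sub[OF 5]] by simp
  next
    case (6 x y f)
    show ?case using Idn_right[OF ob(1)[OF 6(1)] ob(1)[OF 6(2)] sub[OF 6]] by simp
  next
    case (7 x y z f g g')
    show ?case
      using Cmp_add_left[OF ob(1)[OF 7(1)] ob(1)[OF 7(2)] ob(1)[OF 7(3)]
          sub[OF 7(1,2,4)] sub[OF 7(2,3,5)] sub[OF 7(2,3,6)]] by simp
  next
    case (8 x y z f f' g)
    show ?case
      using Cmp_add_right[OF ob(1)[OF 8(1)] ob(1)[OF 8(2)] ob(1)[OF 8(3)]
          sub[OF 8(1,2,4)] sub[OF 8(1,2,5)] sub[OF 8(2,3,6)]] by simp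
  next
    case (9 x y z a f g)
    show ?case
      using Cmp_smult_left[OF ob(1)[OF 9(1)] ob(1)[OF 9(2)] ob(1)[OF 9(3)] 9(4)
          sub[OF 9(1,2,5)] sub[OF 9(2,3,6)]] by simp
  next
    case (10 x y z a f g)
    show ?case
      using Cmp_smult_right[OF ob(1)[OF 10(1)] ob(1)[OF 10(2)] ob(1)[OF 10(3)] 10(4)
          sub[OF 10(1,2,5)] sub[OF 10(2,3,6)]] by simp
  qed
qed


section \<open>The group algebra of a finite group\<close>

lemma (in abelian_monoid) finsum_swap:
  assumes "finite A" and f: "\<And>a b. \<lbrakk>a \<in> A; b \<in> B\<rbrakk> \<Longrightarrow> f a b \<in> carrier G"
  shows "(\<Oplus>a\<in>A. \<Oplus>b\<in>B. f a b) = (\<Oplus>b\<in>B. \<Oplus>a\<in>A. f a b)"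
  using assms(1) f
proof (induction A)
  case empty
  then show ?case by simp
next
  case (insert x A)
  have "(\<Oplus>b\<in>B. \<Oplus>a\<in>insert x A. f a b) = (\<Oplus>b\<in>B. f x b \<oplus> (\<Oplus>a\<in>A. f a b))"
    using insert by (intro finsum_cong') (auto simp: Pi_def)
  also have "\<dots> = (\<Oplus>b\<in>B. f x b) \<oplus> (\<Oplus>b\<in>B. \<Oplus>a\<in>A. f a b)"
    using insert by (intro finsum_addf) (auto simp: Pi_def)
  also have "\<dots> = (\<Oplus>a\<in>insert x A. \<Oplus>b\<in>B. f a b)"
    using insert by (subst finsum_insert) (auto simp: Pi_def)
  finally show ?case by simp
qed

locale finite_group_algebra = G: group G + K: field K
  for G :: "('g, 'd) monoid_scheme" and K :: "('k, 'c) ring_scheme" +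
  assumes finite_G: "finite (carrier G)"
begin

abbreviation kG :: "('k, 'g \<Rightarrow> 'k) module" where
  "kG \<equiv> group_algebra K G"

abbreviation e :: "'g \<Rightarrow> 'g \<Rightarrow> 'k" where
  "e \<equiv> group_basis K G"

lemma carrier_kG: "carrier kG = carrier G \<rightarrow>\<^sub>E carrier K"
  using finite_G by (auto simp: group_algebra_def)

lemma kG_simps:
  "\<zero>\<^bsub>kG\<^esub> = (\<lambda>x\<in>carrier G. \<zero>\<^bsub>K\<^esub>)"
  "\<one>\<^bsub>kG\<^esub> = e \<one>\<^bsub>G\<^esub>"
  "f \<oplus>\<^bsub>kG\<^esub> h = (\<lambda>x\<in>carrier G. f x \<oplus>\<^bsub>K\<^esub> h x)"
  "a \<odot>\<^bsub>kG\<^esub> f = (\<lambda>x\<in>carrier G. a \<otimes>\<^bsub>K\<^esub> f x)"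
  by (simp_all add: group_algebra_def group_basis_def)

lemma kG_apply:
  assumes "x \<in> carrier G"
  shows "\<zero>\<^bsub>kG\<^esub> x = \<zero>\<^bsub>K\<^esub>" "(f \<oplus>\<^bsub>kG\<^esub> h) x = f x \<oplus>\<^bsub>K\<^esub> h x" "(a \<odot>\<^bsub>kG\<^esub> f) x = a \<otimes>\<^bsub>K\<^esub> f x"
    "e g x = (if x = g then \<one>\<^bsub>K\<^esub> else \<zero>\<^bsub>K\<^esub>)"
  using assms by (simp_all add: kG_simps group_basis_def)

lemma kG_coeff_closed: "\<lbrakk>f \<in> carrier kG; x \<in> carrier G\<rbrakk> \<Longrightarrow> f x \<in> carrier K"
  by (auto simp: carrier_kG)

lemma kG_eqI:
  "\<lbrakk>f \<in> carrier kG; h \<in> carrier kG; \<And>x. x \<in> carrier G \<Longrightarrow> f x = h x\<rbrakk> \<Longrightarrow> f = h"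
  unfolding carrier_kG by (rule PiE_ext)

lemma basis_closed: "e g \<in> carrier kG"
  by (auto simp: carrier_kG group_basis_def)

lemma kG_one_closed: "\<one>\<^bsub>kG\<^esub> \<in> carrier kG"
  by (simp add: kG_simps(2) basis_closed)

text \<open>
  Since \<open>G\<close> is finite, the convolution may sum over all of \<open>G\<close> instead of the support of the left
  factor.  The index set then no longer depends on that factor, as the algebra laws below require.
\<close>

lemma kG_mult:
  assumes "f \<in> carrier kG" "h \<in> carrier kG"
  shows "f \<otimes>\<^bsub>kG\<^esub> h =
    (\<lambda>x\<in>carrier G. \<Oplus>\<^bsub>K\<^esub>a\<in>carrier G. f a \<otimes>\<^bsub>K\<^esub> h (inv\<^bsub>G\<^esub> a \<otimes>\<^bsub>G\<^esub> x))"
proof -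
  have "(\<Oplus>\<^bsub>K\<^esub>a\<in>{a \<in> carrier G. f a \<noteq> \<zero>\<^bsub>K\<^esub>}. f a \<otimes>\<^bsub>K\<^esub> h (inv\<^bsub>G\<^esub> a \<otimes>\<^bsub>G\<^esub> x))
    = (\<Oplus>\<^bsub>K\<^esub>a\<in>carrier G. f a \<otimes>\<^bsub>K\<^esub> h (inv\<^bsub>G\<^esub> a \<otimes>\<^bsub>G\<^esub> x))" if "x \<in> carrier G" for x
    using that assms finite_G
    by (intro K.add.finprod_mono_neutral_cong_left) (auto simp: kG_coeff_closed)
  then show ?thesis by (auto simp: group_algebra_def restrict_def)
qed

lemma kG_mult_closed:
  assumes "f \<in> carrier kG" "h \<in> carrier kG"
  shows "f \<otimes>\<^bsub>kG\<^esub> h \<in> carrier kG"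
  using assms by (auto simp: kG_mult carrier_kG intro!: K.finsum_closed)

lemma kG_add_closed: "\<lbrakk>f \<in> carrier kG; h \<in> carrier kG\<rbrakk> \<Longrightarrow> f \<oplus>\<^bsub>kG\<^esub> h \<in> carrier kG"
  by (auto simp: kG_simps carrier_kG)

lemma kG_smult_closed: "\<lbrakk>a \<in> carrier K; f \<in> carrier kG\<rbrakk> \<Longrightarrow> a \<odot>\<^bsub>kG\<^esub> f \<in> carrier kG"
  by (auto simp: kG_simps carrier_kG)

lemma kG_zero_closed: "\<zero>\<^bsub>kG\<^esub> \<in> carrier kG"
  by (auto simp: kG_simps carrier_kG)

lemmas kG_coeffs = kG_apply kG_coeff_closed kG_add_closed kG_smult_closed kG_zero_closed

lemma kG_module: "module K kG"
proof (rule moduleI)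
  show "cring K" by (rule K.is_cring)
  show "abelian_group kG"
  proof (rule abelian_groupI)
    fix f assume f: "f \<in> carrier kG"
    show "\<exists>h\<in>carrier kG. h \<oplus>\<^bsub>kG\<^esub> f = \<zero>\<^bsub>kG\<^esub>"
    proof
      show "(\<lambda>x\<in>carrier G. \<ominus>\<^bsub>K\<^esub> f x) \<in> carrier kG" using f by (auto simp: carrier_kG)
      show "(\<lambda>x\<in>carrier G. \<ominus>\<^bsub>K\<^esub> f x) \<oplus>\<^bsub>kG\<^esub> f = \<zero>\<^bsub>kG\<^esub>"
        using kG_coeff_closed[OF f] by (auto simp: kG_simps K.l_neg intro!: restrict_ext)
    qed
    show "\<zero>\<^bsub>kG\<^esub> \<oplus>\<^bsub>kG\<^esub> f = f"
      using f by (intro kG_eqI kG_add_closed kG_zero_closed) (simp_all add: kG_apply kG_coeff_closed)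
  qed (auto simp: kG_coeffs K.a_ac intro!: kG_eqI)
qed (auto simp: kG_coeffs K.l_distr K.r_distr K.m_assoc intro!: kG_eqI)

sublocale kG: k_vector_space K kG
  by (intro k_vector_space.intro kG_module K.field_axioms)

text \<open>
  Both products have at \<open>x\<close> the sum over \<open>a\<close> and \<open>b\<close> of \<open>f(a) h(a\<inverse> b) l(b\<inverse> x)\<close>: on the right
  after the order of summation has been exchanged and \<open>b\<close> replaced by \<open>a b\<close>.
\<close>

lemma kG_m_assoc:
  assumes f: "f \<in> carrier kG" and h: "h \<in> carrier kG" and l: "l \<in> carrier kG"
  shows "(f \<otimes>\<^bsub>kG\<^esub> h) \<otimes>\<^bsub>kG\<^esub> l = f \<otimes>\<^bsub>kG\<^esub> (h \<otimes>\<^bsub>kG\<^esub> l)"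
proof (rule kG_eqI)
  note [simp] = kG_coeff_closed[OF f] kG_coeff_closed[OF h] kG_coeff_closed[OF l]
  fix x assume x: "x \<in> carrier G"
  let ?t = "\<lambda>a b. f a \<otimes>\<^bsub>K\<^esub> (h (inv\<^bsub>G\<^esub> a \<otimes>\<^bsub>G\<^esub> b) \<otimes>\<^bsub>K\<^esub> l (inv\<^bsub>G\<^esub> b \<otimes>\<^bsub>G\<^esub> x))"
  have "((f \<otimes>\<^bsub>kG\<^esub> h) \<otimes>\<^bsub>kG\<^esub> l) x = (\<Oplus>\<^bsub>K\<^esub>b\<in>carrier G. \<Oplus>\<^bsub>K\<^esub>a\<in>carrier G. ?t a b)"
    using x finite_G unfolding kG_mult[OF kG_mult_closed[OF f h] l]
    by (auto simp: kG_mult[OF f h] K.finsum_ldistr K.m_assoc intro!: K.finsum_cong')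
  also have "\<dots> = (\<Oplus>\<^bsub>K\<^esub>a\<in>carrier G. \<Oplus>\<^bsub>K\<^esub>b\<in>carrier G. ?t a b)"
    using x finite_G by (intro K.finsum_swap) auto
  also have "\<dots> = (\<Oplus>\<^bsub>K\<^esub>a\<in>carrier G. f a \<otimes>\<^bsub>K\<^esub> (h \<otimes>\<^bsub>kG\<^esub> l) (inv\<^bsub>G\<^esub> a \<otimes>\<^bsub>G\<^esub> x))"
  proof (rule K.finsum_cong'[OF refl])
    fix a assume a: "a \<in> carrier G"
    have cancel: "inv\<^bsub>G\<^esub> a \<otimes>\<^bsub>G\<^esub> (a \<otimes>\<^bsub>G\<^esub> b) = b" if "b \<in> carrier G" for b
      using a that by (simp flip: G.m_assoc)
    have "(\<Oplus>\<^bsub>K\<^esub>b\<in>carrier G. ?t a b) = (\<Oplus>\<^bsub>K\<^esub>b\<in>(\<lambda>b. a \<otimes>\<^bsub>G\<^esub> b) ` carrier G. ?t a b)"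
      using a by (simp add: G.surj_const_mult)
    also have "\<dots> = (\<Oplus>\<^bsub>K\<^esub>b\<in>carrier G. ?t a (a \<otimes>\<^bsub>G\<^esub> b))"
      using a x by (intro K.finsum_reindex) (auto simp: G.inj_on_cmult)
    also have "\<dots> = (\<Oplus>\<^bsub>K\<^esub>b\<in>carrier G.
        f a \<otimes>\<^bsub>K\<^esub> (h b \<otimes>\<^bsub>K\<^esub> l (inv\<^bsub>G\<^esub> b \<otimes>\<^bsub>G\<^esub> (inv\<^bsub>G\<^esub> a \<otimes>\<^bsub>G\<^esub> x))))"
      using a x by (intro K.finsum_cong') (auto simp: G.inv_mult_group G.m_assoc cancel)
    also have "\<dots> = f a \<otimes>\<^bsub>K\<^esub> (h \<otimes>\<^bsub>kG\<^esub> l) (inv\<^bsub>G\<^esub> a \<otimes>\<^bsub>G\<^esub> x)"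
      using a x finite_G by (simp add: kG_mult[OF h l] K.finsum_rdistr Pi_def)
    finally show "(\<Oplus>\<^bsub>K\<^esub>b\<in>carrier G. ?t a b) = f a \<otimes>\<^bsub>K\<^esub> (h \<otimes>\<^bsub>kG\<^esub> l) (inv\<^bsub>G\<^esub> a \<otimes>\<^bsub>G\<^esub> x)" .
  qed (use x kG_coeff_closed[OF kG_mult_closed[OF h l]] in auto)
  also have "\<dots> = (f \<otimes>\<^bsub>kG\<^esub> (h \<otimes>\<^bsub>kG\<^esub> l)) x"
    using x by (simp add: kG_mult[OF f kG_mult_closed[OF h l]])
  finally show "((f \<otimes>\<^bsub>kG\<^esub> h) \<otimes>\<^bsub>kG\<^esub> l) x = (f \<otimes>\<^bsub>kG\<^esub> (h \<otimes>\<^bsub>kG\<^esub> l)) x" .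
qed (use assms kG_mult_closed in auto)

lemma basis_mult:
  assumes g: "g \<in> carrier G" and h: "h \<in> carrier kG"
  shows "e g \<otimes>\<^bsub>kG\<^esub> h = (\<lambda>x\<in>carrier G. h (inv\<^bsub>G\<^esub> g \<otimes>\<^bsub>G\<^esub> x))"
proof -
  have "(\<Oplus>\<^bsub>K\<^esub>a\<in>carrier G. e g a \<otimes>\<^bsub>K\<^esub> h (inv\<^bsub>G\<^esub> a \<otimes>\<^bsub>G\<^esub> x)) = h (inv\<^bsub>G\<^esub> g \<otimes>\<^bsub>G\<^esub> x)"
    if x: "x \<in> carrier G" for x
  proof -
    have "(\<Oplus>\<^bsub>K\<^esub>a\<in>carrier G. e g a \<otimes>\<^bsub>K\<^esub> h (inv\<^bsub>G\<^esub> a \<otimes>\<^bsub>G\<^esub> x))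
      = (\<Oplus>\<^bsub>K\<^esub>a\<in>carrier G. if g = a then h (inv\<^bsub>G\<^esub> a \<otimes>\<^bsub>G\<^esub> x) else \<zero>\<^bsub>K\<^esub>)"
      using x h by (intro K.finsum_cong') (auto simp: group_basis_def kG_coeff_closed)
    also have "\<dots> = h (inv\<^bsub>G\<^esub> g \<otimes>\<^bsub>G\<^esub> x)"
      using g x h finite_G by (intro K.finsum_singleton) (auto simp: kG_coeff_closed)
    finally show ?thesis .
  qed
  then show ?thesis by (auto simp: kG_mult[OF basis_closed h] restrict_def)
qed

lemma basis_mult_basis:
  assumes "g \<in> carrier G" "h \<in> carrier G"
  shows "e g \<otimes>\<^bsub>kG\<^esub> e h = e (g \<otimes>\<^bsub>G\<^esub> h)"
  using assms unfolding basis_mult[OF assms(1) basis_closed]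
  by (auto simp: group_basis_def G.inv_solve_left' restrict_def)

lemma kG_l_one: "f \<in> carrier kG \<Longrightarrow> \<one>\<^bsub>kG\<^esub> \<otimes>\<^bsub>kG\<^esub> f = f"
  by (rule kG_eqI) (auto simp: kG_simps basis_mult carrier_kG)

lemma kG_r_one:
  assumes f: "f \<in> carrier kG"
  shows "f \<otimes>\<^bsub>kG\<^esub> \<one>\<^bsub>kG\<^esub> = f"
proof (rule kG_eqI)
  fix x assume x: "x \<in> carrier G"
  have "(\<Oplus>\<^bsub>K\<^esub>a\<in>carrier G. f a \<otimes>\<^bsub>K\<^esub> e \<one>\<^bsub>G\<^esub> (inv\<^bsub>G\<^esub> a \<otimes>\<^bsub>G\<^esub> x))
    = (\<Oplus>\<^bsub>K\<^esub>a\<in>carrier G. if x = a then f a else \<zero>\<^bsub>K\<^esub>)"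
    using x f by (intro K.finsum_cong')
      (auto simp: group_basis_def kG_coeff_closed G.inv_solve_left')
  also have "\<dots> = f x"
    using x f finite_G by (intro K.finsum_singleton) (auto simp: kG_coeff_closed)
  finally show "(f \<otimes>\<^bsub>kG\<^esub> \<one>\<^bsub>kG\<^esub>) x = f x"
    using x by (simp add: kG_simps(2) kG_mult[OF f basis_closed])
qed (use f kG_mult_closed basis_closed in \<open>auto simp: kG_simps(2)\<close>)

lemma kG_l_distr:
  assumes "f \<in> carrier kG" "f' \<in> carrier kG" "h \<in> carrier kG"
  shows "(f \<oplus>\<^bsub>kG\<^esub> f') \<otimes>\<^bsub>kG\<^esub> h = f \<otimes>\<^bsub>kG\<^esub> h \<oplus>\<^bsub>kG\<^esub> f' \<otimes>\<^bsub>kG\<^esub> h"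
proof (rule kG_eqI)
  fix x assume x: "x \<in> carrier G"
  show "((f \<oplus>\<^bsub>kG\<^esub> f') \<otimes>\<^bsub>kG\<^esub> h) x = (f \<otimes>\<^bsub>kG\<^esub> h \<oplus>\<^bsub>kG\<^esub> f' \<otimes>\<^bsub>kG\<^esub> h) x"
    using assms x unfolding kG_mult[OF kG.a_closed[OF assms(1,2)] assms(3)]
    by (auto simp: kG_mult kG_simps(3) kG_coeff_closed K.l_distr
        simp flip: K.finsum_addf intro!: K.finsum_cong')
qed (use assms kG_mult_closed in auto)

lemma kG_r_distr:
  assumes "f \<in> carrier kG" "h \<in> carrier kG" "h' \<in> carrier kG"
  shows "f \<otimes>\<^bsub>kG\<^esub> (h \<oplus>\<^bsub>kG\<^esub> h') = f \<otimes>\<^bsub>kG\<^esub> h \<oplus>\<^bsub>kG\<^esub> f \<otimes>\<^bsub>kG\<^esub> h'"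
proof (rule kG_eqI)
  fix x assume x: "x \<in> carrier G"
  show "(f \<otimes>\<^bsub>kG\<^esub> (h \<oplus>\<^bsub>kG\<^esub> h')) x = (f \<otimes>\<^bsub>kG\<^esub> h \<oplus>\<^bsub>kG\<^esub> f \<otimes>\<^bsub>kG\<^esub> h') x"
    using assms x unfolding kG_mult[OF assms(1) kG.a_closed[OF assms(2,3)]]
    by (auto simp: kG_mult kG_simps(3) kG_coeff_closed K.r_distr
        simp flip: K.finsum_addf intro!: K.finsum_cong')
qed (use assms kG_mult_closed in auto)

lemma kG_smult_l:
  assumes "a \<in> carrier K" "f \<in> carrier kG" "h \<in> carrier kG"
  shows "(a \<odot>\<^bsub>kG\<^esub> f) \<otimes>\<^bsub>kG\<^esub> h = a \<odot>\<^bsub>kG\<^esub> (f \<otimes>\<^bsub>kG\<^esub> h)"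
proof (rule kG_eqI)
  fix x assume x: "x \<in> carrier G"
  show "((a \<odot>\<^bsub>kG\<^esub> f) \<otimes>\<^bsub>kG\<^esub> h) x = (a \<odot>\<^bsub>kG\<^esub> (f \<otimes>\<^bsub>kG\<^esub> h)) x"
    using assms x finite_G unfolding kG_mult[OF kG.smult_closed[OF assms(1,2)] assms(3)]
    by (auto simp: kG_mult kG_simps(4) kG_coeff_closed K.m_assoc K.finsum_rdistr
        intro!: K.finsum_cong')
qed (use assms kG_mult_closed in auto)

lemma kG_smult_r:
  assumes "a \<in> carrier K" "f \<in> carrier kG" "h \<in> carrier kG"
  shows "f \<otimes>\<^bsub>kG\<^esub> (a \<odot>\<^bsub>kG\<^esub> h) = a \<odot>\<^bsub>kG\<^esub> (f \<otimes>\<^bsub>kG\<^esub> h)"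
proof (rule kG_eqI)
  fix x assume x: "x \<in> carrier G"
  show "(f \<otimes>\<^bsub>kG\<^esub> (a \<odot>\<^bsub>kG\<^esub> h)) x = (a \<odot>\<^bsub>kG\<^esub> (f \<otimes>\<^bsub>kG\<^esub> h)) x"
    using assms x finite_G unfolding kG_mult[OF assms(2) kG.smult_closed[OF assms(1,3)]]
    by (auto simp: kG_mult kG_simps(4) kG_coeff_closed K.m_lcomm K.finsum_rdistr
        intro!: K.finsum_cong')
qed (use assms kG_mult_closed in auto)

abbreviation \<A> :: "(unit, 'k, 'g \<Rightarrow> 'k) kcat" where
  "\<A> \<equiv> algebra_category kG"

lemma \<A>_simps [simp]:
  "Ob \<A> = {()}" "Mor \<A> y x = kG" "Cmp \<A> z y x g f = g \<otimes>\<^bsub>kG\<^esub> f" "Idn \<A> x = \<one>\<^bsub>kG\<^esub>"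
  by (simp_all add: algebra_category_def)

lemma \<A>_k_category: "k_category K \<A>"
  by (intro k_category.intro k_category_axioms.intro K.field_axioms; simp only: \<A>_simps)
    (rule kG_module kG_one_closed kG_mult_closed kG_m_assoc kG_l_one kG_r_one
      kG_l_distr kG_r_distr kG_smult_l kG_smult_r; assumption)+

abbreviation X :: "'g \<Rightarrow> unit \<Rightarrow> unit \<Rightarrow> ('g \<Rightarrow> 'k) set" where
  "X \<equiv> usual_grading K G"

lemma basis_nonzero: "g \<in> carrier G \<Longrightarrow> e g \<noteq> \<zero>\<^bsub>kG\<^esub>"
  by (auto simp: group_basis_def kG_simps restrict_def fun_eq_iff)

text \<open>Tests membership on values, which is how sums of homogeneous elements are evaluated below.\<close>

lemma mem_X_iff:
  assumes "g \<in> carrier G" "f \<in> carrier kG"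
  shows "f \<in> X g y x \<longleftrightarrow> (\<forall>h\<in>carrier G. h \<noteq> g \<longrightarrow> f h = \<zero>\<^bsub>K\<^esub>)"
proof
  assume "f \<in> X g y x"
  then show "\<forall>h\<in>carrier G. h \<noteq> g \<longrightarrow> f h = \<zero>\<^bsub>K\<^esub>"
    by (auto simp: usual_grading_def group_basis_def kG_simps)
next
  assume "\<forall>h\<in>carrier G. h \<noteq> g \<longrightarrow> f h = \<zero>\<^bsub>K\<^esub>"
  then have "f = f g \<odot>\<^bsub>kG\<^esub> e g"
    using assms by (intro kG_eqI kG.smult_closed basis_closed)
      (auto simp: kG_coeff_closed kG_simps(4) group_basis_def)
  then show "f \<in> X g y x"
    using assms by (auto simp: usual_grading_def kG_coeff_closed)
qed

lemma X_subset: "X g y x \<subseteq> carrier kG"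
  by (auto simp: usual_grading_def basis_closed)

lemma X_memI: "a \<in> carrier K \<Longrightarrow> a \<odot>\<^bsub>kG\<^esub> e g \<in> X g y x"
  by (auto simp: usual_grading_def)

lemma X_memE:
  assumes "f \<in> X g y x"
  obtains a where "a \<in> carrier K" "f = a \<odot>\<^bsub>kG\<^esub> e g"
  using assms by (auto simp: usual_grading_def)

lemma basis_mem_X: "e g \<in> X g y x"
  using X_memI[of "\<one>\<^bsub>K\<^esub>" g] basis_closed by simp

lemma X_submodule: "submodule (X g y x) K kG"
proof (rule kG.submoduleI)
  show "X g y x \<subseteq> carrier kG" by (rule X_subset)
  show "\<zero>\<^bsub>kG\<^esub> \<in> X g y x"
    using X_memI[of "\<zero>\<^bsub>K\<^esub>" g] basis_closed by simp
  show "\<ominus>\<^bsub>kG\<^esub> f \<in> X g y x" if "f \<in> X g y x" for f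
    using that by (elim X_memE) (simp add: basis_closed X_memI flip: kG.smult_l_minus)
  show "f \<oplus>\<^bsub>kG\<^esub> h \<in> X g y x" if "f \<in> X g y x" "h \<in> X g y x" for f h
    using that by (elim X_memE) (simp add: basis_closed X_memI flip: kG.smult_l_distr)
  show "a \<odot>\<^bsub>kG\<^esub> f \<in> X g y x" if "a \<in> carrier K" "f \<in> X g y x" for a f
    using that by (elim X_memE) (simp add: basis_closed X_memI flip: kG.smult_assoc1)
qed

lemma smult_basis_mult:
  assumes "s \<in> carrier G" "t \<in> carrier G" "a \<in> carrier K" "b \<in> carrier K"
  shows "(b \<odot>\<^bsub>kG\<^esub> e t) \<otimes>\<^bsub>kG\<^esub> (a \<odot>\<^bsub>kG\<^esub> e s) = (b \<otimes>\<^bsub>K\<^esub> a) \<odot>\<^bsub>kG\<^esub> e (t \<otimes>\<^bsub>G\<^esub> s)"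
proof -
  have "(b \<odot>\<^bsub>kG\<^esub> e t) \<otimes>\<^bsub>kG\<^esub> (a \<odot>\<^bsub>kG\<^esub> e s) = b \<odot>\<^bsub>kG\<^esub> (e t \<otimes>\<^bsub>kG\<^esub> (a \<odot>\<^bsub>kG\<^esub> e s))"
    using assms by (intro kG_smult_l) (auto simp: basis_closed)
  also have "e t \<otimes>\<^bsub>kG\<^esub> (a \<odot>\<^bsub>kG\<^esub> e s) = a \<odot>\<^bsub>kG\<^esub> e (t \<otimes>\<^bsub>G\<^esub> s)"
    using assms by (simp add: kG_smult_r basis_closed basis_mult_basis)
  finally show ?thesis using assms by (simp add: basis_closed kG.smult_assoc1)
qed

lemma X_mult:
  assumes "s \<in> carrier G" "t \<in> carrier G" "f \<in> X s y x" "h \<in> X t z y"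
  shows "h \<otimes>\<^bsub>kG\<^esub> f \<in> X (t \<otimes>\<^bsub>G\<^esub> s) z x"
  using assms by (elim X_memE) (simp add: smult_basis_mult X_memI)

lemma finsum_kG_coeff:
  assumes "finite A" "c \<in> A \<rightarrow> carrier kG" "x \<in> carrier G"
  shows "finsum kG c A x = (\<Oplus>\<^bsub>K\<^esub>g\<in>A. c g x)"
  using assms(1,2)
proof (induction A)
  case empty
  then show ?case using assms(3) by (simp add: kG_simps)
next
  case (insert g A)
  then have "c g \<in> carrier kG" "c \<in> A \<rightarrow> carrier kG" by auto
  then show ?case
    using insert assms(3) kG_coeff_closed by (subst kG.finsum_insert) (auto simp: kG_simps(3) Pi_def)
qed

text \<open>
  In a sum of homogeneous elements only the component of degree \<open>u\<close> contributes to the value at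
  \<open>u\<close>.  So the components of \<open>f\<close> are forced to be \<open>f(g) e\<^sub>g\<close>, and these do add up to \<open>f\<close>.
\<close>

lemma X_direct_sum: "internal_direct_sum kG (carrier G) (\<lambda>g. X g y x)"
  unfolding internal_direct_sum_def
proof
  fix f assume f: "f \<in> carrier kG"
  have coeff: "finsum kG c {g \<in> carrier G. c g \<noteq> \<zero>\<^bsub>kG\<^esub>} u = c u u"
    if c: "c \<in> (\<Pi>\<^sub>E g\<in>carrier G. X g y x)" and u: "u \<in> carrier G" for c u
  proof -
    have cX: "c g \<in> X g y x" "c g \<in> carrier kG" if "g \<in> carrier G" for g
      using c X_subset that by blast+
    have "finsum kG c {g \<in> carrier G. c g \<noteq> \<zero>\<^bsub>kG\<^esub>} u = finsum kG c (carrier G) u"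
      using finite_G cX
      by (subst kG.add.finprod_mono_neutral_cong_left[of "carrier G"]) auto
    also have "\<dots> = (\<Oplus>\<^bsub>K\<^esub>g\<in>carrier G. c g u)"
      using finite_G cX u by (intro finsum_kG_coeff) auto
    also have "\<dots> = (\<Oplus>\<^bsub>K\<^esub>g\<in>carrier G. if u = g then c g u else \<zero>\<^bsub>K\<^esub>)"
      using cX u mem_X_iff[OF _ cX(2)]
      by (intro K.finsum_cong') (auto simp: kG_coeff_closed)
    also have "\<dots> = c u u"
      using finite_G cX u by (intro K.finsum_singleton) (auto simp: kG_coeff_closed)
    finally show ?thesis .
  qed
  show "\<exists>!c. c \<in> (\<Pi>\<^sub>E g\<in>carrier G. X g y x) \<and> finite {g \<in> carrier G. c g \<noteq> \<zero>\<^bsub>kG\<^esub>} \<and>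
      f = finsum kG c {g \<in> carrier G. c g \<noteq> \<zero>\<^bsub>kG\<^esub>}"
  proof (rule ex1I)
    let ?c = "\<lambda>g\<in>carrier G. f g \<odot>\<^bsub>kG\<^esub> e g"
    have c: "?c \<in> (\<Pi>\<^sub>E g\<in>carrier G. X g y x)"
      using f by (auto simp: usual_grading_def kG_coeff_closed)
    have "f = finsum kG ?c {g \<in> carrier G. ?c g \<noteq> \<zero>\<^bsub>kG\<^esub>}"
    proof (rule kG_eqI)
      show "finsum kG ?c {g \<in> carrier G. ?c g \<noteq> \<zero>\<^bsub>kG\<^esub>} \<in> carrier kG"
        using f by (intro kG.finsum_closed) (auto simp: basis_closed kG_coeff_closed)
      show "f u = finsum kG ?c {g \<in> carrier G. ?c g \<noteq> \<zero>\<^bsub>kG\<^esub>} u" if "u \<in> carrier G" for u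
        using coeff[OF c that] that f by (simp add: kG_simps(4) group_basis_def kG_coeff_closed)
    qed (rule f)
    with c show "?c \<in> (\<Pi>\<^sub>E g\<in>carrier G. X g y x) \<and> finite {g \<in> carrier G. ?c g \<noteq> \<zero>\<^bsub>kG\<^esub>} \<and>
        f = finsum kG ?c {g \<in> carrier G. ?c g \<noteq> \<zero>\<^bsub>kG\<^esub>}"
      using finite_G by auto
    fix c
    assume c': "c \<in> (\<Pi>\<^sub>E g\<in>carrier G. X g y x) \<and> finite {g \<in> carrier G. c g \<noteq> \<zero>\<^bsub>kG\<^esub>} \<and>
        f = finsum kG c {g \<in> carrier G. c g \<noteq> \<zero>\<^bsub>kG\<^esub>}"
    have "c g = ?c g" if g: "g \<in> carrier G" for g
    proof -
      have cg: "c g \<in> X g y x" "c g \<in> carrier kG" using c' g X_subset by blast+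
      have "c g g = f g" using coeff[of c g] c' g by simp
      then show ?thesis
        using mem_X_iff[OF g cg(2)] cg g f
        by (intro kG_eqI) (auto simp: kG_coeff_closed basis_closed,
            auto simp: kG_coeff_closed kG_simps(4) group_basis_def)
    qed
    then show "c = ?c" using PiE_ext[OF conjunct1[OF c'] c] by blast
  qed
qed

lemma usual_grading_kG: "k_category_grading K \<A> G X"
  by (intro k_category_grading.intro k_category_grading_axioms.intro \<A>_k_category G.is_group)
    (auto simp: X_submodule X_direct_sum X_mult)

sublocale \<A>: k_category_grading K \<A> G X by (rule usual_grading_kG)

text \<open>The one-step walk along the basis element of \<open>s\<close> already has degree \<open>s\<close>.\<close>

lemma connected_usual_grading: "connected_grading K \<A> G X"
  unfolding connected_grading_def
proof (intro conjI usual_grading_kG ballI)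
  fix x y :: unit and s assume s: "s \<in> carrier G"
  let ?f = "Arrow y x (e s)"
  have "arrow_deg G X ?f = s"
    unfolding arrow_deg_def
  proof (rule the_equality)
    show "s \<in> carrier G \<and> mor ?f \<in> X s (target ?f) (source ?f)"
      using s basis_mem_X by simp
    show "t = s" if "t \<in> carrier G \<and> mor ?f \<in> X t (target ?f) (source ?f)" for t
      using kG.direct_sum_components_disjoint[OF X_direct_sum X_submodule, of t s "e s"]
        that s basis_mem_X basis_nonzero by auto
  qed
  then have "walk_deg G X [(?f, 1)] = s"
    using s by (simp add: walk_deg_def)
  moreover have "nonzero_walk \<A> y x [(?f, 1)]"
    using basis_nonzero[OF s]
    by (simp add: nonzero_walk_def nonzero_arrow_def step_target_def step_source_def basis_closed)
  moreover have "homogeneous_walk G X [(?f, 1)]"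
    using s basis_mem_X[of s] by (auto simp: homogeneous_walk_def homogeneous_def)
  ultimately show "\<exists>w. nonzero_walk \<A> y x w \<and> homogeneous_walk G X w \<and> walk_deg G X w = s" by blast
qed


section \<open>The smash product of the group algebra with its group\<close>

text \<open>
  The morphisms from \<open>x\<close> to \<open>y\<close> form the line spanned by one basis element of \<open>kG\<close>.  Composites of
  non-zero morphisms are non-zero because the product of two basis elements is a basis element
  and \<open>K\<close> has no zero divisors.
\<close>

lemma line_category_smash: "line_category K (smash \<A> G X)"
proof -
  have smash: "k_category K (smash \<A> G X)"
    by (rule \<A>.smash_k_category) (simp add: kG_simps(2) basis_mem_X)
  show ?thesis
  proof (intro line_category.intro line_category_axioms.intro smash)
    fix x y assume "x \<in> Ob (smash \<A> G X)" "y \<in> Ob (smash \<A> G X)"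
    then have s: "inv\<^bsub>G\<^esub> (snd y) \<otimes>\<^bsub>G\<^esub> snd x \<in> carrier G" by auto
    show "\<exists>f \<in> carrier (Mor (smash \<A> G X) y x). f \<noteq> \<zero>\<^bsub>Mor (smash \<A> G X) y x\<^esub> \<and>
      carrier (Mor (smash \<A> G X) y x) = {a \<odot>\<^bsub>Mor (smash \<A> G X) y x\<^esub> f | a. a \<in> carrier K}"
    proof (intro bexI conjI)
      let ?e = "e (inv\<^bsub>G\<^esub> (snd y) \<otimes>\<^bsub>G\<^esub> snd x)"
      show "?e \<noteq> \<zero>\<^bsub>Mor (smash \<A> G X) y x\<^esub>" using basis_nonzero[OF s] by simp
      show "carrier (Mor (smash \<A> G X) y x) = {a \<odot>\<^bsub>Mor (smash \<A> G X) y x\<^esub> ?e | a. a \<in> carrier K}"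
        by (simp add: usual_grading_def)
      show "?e \<in> carrier (Mor (smash \<A> G X) y x)" by (simp add: basis_mem_X)
    qed
  next
    fix x y z f g
    assume ob: "x \<in> Ob (smash \<A> G X)" "y \<in> Ob (smash \<A> G X)" "z \<in> Ob (smash \<A> G X)"
      and f: "f \<in> carrier (Mor (smash \<A> G X) y x)" "f \<noteq> \<zero>\<^bsub>Mor (smash \<A> G X) y x\<^esub>"
      and g: "g \<in> carrier (Mor (smash \<A> G X) z y)" "g \<noteq> \<zero>\<^bsub>Mor (smash \<A> G X) z y\<^esub>"
    let ?s = "inv\<^bsub>G\<^esub> (snd y) \<otimes>\<^bsub>G\<^esub> snd x" and ?t = "inv\<^bsub>G\<^esub> (snd z) \<otimes>\<^bsub>G\<^esub> snd y"
    have st: "?s \<in> carrier G" "?t \<in> carrier G" using ob by auto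
    obtain a where a: "a \<in> carrier K" "f = a \<odot>\<^bsub>kG\<^esub> e ?s" using f(1) by (auto elim: X_memE)
    obtain b where b: "b \<in> carrier K" "g = b \<odot>\<^bsub>kG\<^esub> e ?t" using g(1) by (auto elim: X_memE)
    have ab: "a \<noteq> \<zero>\<^bsub>K\<^esub>" "b \<noteq> \<zero>\<^bsub>K\<^esub>" using a b f(2) g(2) basis_closed by auto
    have "g \<otimes>\<^bsub>kG\<^esub> f = (b \<otimes>\<^bsub>K\<^esub> a) \<odot>\<^bsub>kG\<^esub> e (?t \<otimes>\<^bsub>G\<^esub> ?s)"
      using a b st by (simp add: smult_basis_mult)
    then have "(g \<otimes>\<^bsub>kG\<^esub> f) (?t \<otimes>\<^bsub>G\<^esub> ?s) = b \<otimes>\<^bsub>K\<^esub> a"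
      using a b st by (simp add: kG_simps(4) group_basis_def)
    moreover have "b \<otimes>\<^bsub>K\<^esub> a \<noteq> \<zero>\<^bsub>K\<^esub>" using a b ab K.integral by blast
    ultimately have "g \<otimes>\<^bsub>kG\<^esub> f \<noteq> \<zero>\<^bsub>kG\<^esub>" using st by (auto simp: kG_simps(1))
    then show "Cmp (smash \<A> G X) z y x g f \<noteq> \<zero>\<^bsub>Mor (smash \<A> G X) z x\<^esub>"
      by simp
  qed
qed

end

theorem proposition5p1:
  fixes G :: "('g, 'd) monoid_scheme" and K :: "('k, 'c) ring_scheme"
  assumes "group G" and "finite (carrier G)" and "field K"
  shows "simply_connected_grading TYPE('h) K
    (algebra_category (group_algebra K G)) G (usual_grading K G)"
proof -
  interpret finite_group_algebra G K
    using assms by (simp add: finite_group_algebra_def finite_group_algebra_axioms_def)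
  interpret smash: line_category K "smash \<A> G X" by (rule line_category_smash)
  have "Ob (smash \<A> G X) \<noteq> {}" using G.one_closed by auto
  then show ?thesis
    unfolding simply_connected_grading_def simply_connected_k_category_def
    using connected_usual_grading smash.connected smash.connected_grading_trivial by blast
qed

end
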